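(* There exist a large set of H-designs LH$(11,g,5,4)$ and a large set of H-designs LH$(12,g,6,5)$ for each integer $g\geq 2$, with possible exceptions when $g\in\{3,5,7,9,11,13\}$.
   Context: An H-design H$(n,g,k,t)$ is a triple $(Q,G,B)$ where $Q$ is a set of $ng$ points, $G$ is a partition of $Q$ into $n$ groups of size $g$, and $B$ is a set of $k$-subsets of $Q$ (blocks) such that each block meets each group in at most one point and any $t$ points from $t$ distinct groups lie in exactly one block. A large set of H-designs LH$(n,g,k,t)$ is a partition of the set of all $k$-subsets of $Q$ meeting each group of $G$ in at most one point into pairwise disjoint block sets, each of which forms (with $Q$ and $G$) an H-design H$(n,g,k,t)$. *)

theory Defs
  imports "HOL-Library.Disjoint_Sets"
begin

definition transverse :: "'a set set \<Rightarrow> 'a set \<Rightarrow> bool" where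
  "transverse G S \<longleftrightarrow> (\<forall>X\<in>G. card (S \<inter> X) \<le> 1)"

definition group_structure :: "nat \<Rightarrow> nat \<Rightarrow> 'a set \<Rightarrow> 'a set set \<Rightarrow> bool" where
  "group_structure n g Q G \<longleftrightarrow>
     finite Q \<and> card Q = n * g \<and> partition_on Q G \<and> card G = n \<and> (\<forall>X\<in>G. card X = g)"

definition admissible_sets :: "nat \<Rightarrow> 'a set \<Rightarrow> 'a set set \<Rightarrow> 'a set set" where
  "admissible_sets k Q G = {S. S \<subseteq> Q \<and> card S = k \<and> transverse G S}"

definition H_design :: "nat \<Rightarrow> nat \<Rightarrow> nat \<Rightarrow> nat \<Rightarrow> 'a set \<Rightarrow> 'a set set \<Rightarrow> 'a set set \<Rightarrow> bool" where
  "H_design n g k t Q G B \<longleftrightarrow>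
     group_structure n g Q G \<and>
     B \<subseteq> admissible_sets k Q G \<and>
     (\<forall>T \<in> admissible_sets t Q G. \<exists>!b. b \<in> B \<and> T \<subseteq> b)"

definition large_H_set :: "nat \<Rightarrow> nat \<Rightarrow> nat \<Rightarrow> nat \<Rightarrow> 'a set \<Rightarrow> 'a set set \<Rightarrow> 'a set set set \<Rightarrow> bool" where
  "large_H_set n g k t Q G L \<longleftrightarrow>
     group_structure n g Q G \<and>
     partition_on (admissible_sets k Q G) L \<and>
     (\<forall>B\<in>L. H_design n g k t Q G B)"

end

theory Submission
  imports Defs
begin

text \<open>
  Suppose that finitely many (not necessarily distinct) Steiner systems S(5,6,12) on the same twelve
  points contain every 6-set exactly \<open>g\<close> times. Index the groups by the twelve points and label
  the points of each group by the residues modulo \<open>g\<close>. A transverse 6-set lies over a 6-set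
  \<open>K\<close>, which belongs to exactly \<open>g\<close> of the systems, and its label sum modulo
  \<open>g\<close> selects one of these. The classes of this selection form a large set: a transverse
  5-set and a system determine the sixth group, and the rank of the system among those containing
  \<open>K\<close> determines the missing label.

  Concatenation adds the multiplicities \<open>g\<close>, so multiplicities 2 and 3 suffice. They are
  realised by 14 copies of S(5,6,12), eleven of which form an orbit of an 11-cycle, and by the 21 copies
  in one orbit of a permutation of cycle type (7,3,1,1); both were found by a computer search over
  unions of orbits of cyclic groups. Deriving at a point turns a covering family of S(5,6,12) into
  one of S(4,5,11).
\<close>

section \<open>Steiner systems, multiple coverings and derivation\<close>

definition steiner :: "nat \<Rightarrow> nat \<Rightarrow> nat \<Rightarrow> nat set set \<Rightarrow> bool" where
  "steiner t k n B \<longleftrightarrow>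
     (\<forall>b\<in>B. b \<subseteq> {..<n} \<and> card b = k) \<and>
     (\<forall>U. U \<subseteq> {..<n} \<and> card U = t \<longrightarrow> (\<exists>!b. b \<in> B \<and> U \<subseteq> b))"

text \<open>A list, not a set: repeated copies count with multiplicity, and the order later ranks
  the systems that contain a given \<open>K\<close>.\<close>

definition steiner_cover :: "nat \<Rightarrow> nat \<Rightarrow> nat \<Rightarrow> nat \<Rightarrow> nat set set list \<Rightarrow> bool" where
  "steiner_cover t k n g Fs \<longleftrightarrow>
     (\<forall>B\<in>set Fs. steiner t k n B) \<and>
     (\<forall>K. K \<subseteq> {..<n} \<and> card K = k \<longrightarrow> length (filter (\<lambda>B. K \<in> B) Fs) = g)"

lemma steiner_ex1:
  assumes "steiner t k n B" "U \<subseteq> {..<n}" "card U = t"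
  shows "\<exists>!b. b \<in> B \<and> U \<subseteq> b"
  using assms(1)[unfolded steiner_def, THEN conjunct2, rule_format, OF conjI, OF assms(2,3)] .

lemma steiner_block:
  assumes "steiner t k n B" "b \<in> B"
  shows "b \<subseteq> {..<n}" "card b = k"
  using assms(1)[unfolded steiner_def, THEN conjunct1] assms(2) by auto

lemma steiner_cover_count:
  assumes "steiner_cover t k n g Fs" "K \<subseteq> {..<n}" "card K = k"
  shows "length (filter (\<lambda>B. K \<in> B) Fs) = g"
  using assms(1)[unfolded steiner_cover_def, THEN conjunct2, rule_format, OF conjI, OF assms(2,3)] .

lemma steiner_cover_append:
  assumes "steiner_cover t k n g Fs" "steiner_cover t k n h Gs"
  shows "steiner_cover t k n (g + h) (Fs @ Gs)"
  using assms unfolding steiner_cover_def by auto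

text \<open>The derived design at the point \<open>n\<close>: the unique block over
  \<open>insert n U\<close> loses \<open>n\<close> and becomes the unique derived block over
  \<open>U\<close>.\<close>

lemma steiner_derived:
  assumes "steiner (Suc t) (Suc k) (Suc n) B"
  shows "steiner t k n {b. b \<subseteq> {..<n} \<and> insert n b \<in> B}"
  unfolding steiner_def
proof (intro conjI ballI allI impI)
  fix b assume b: "b \<in> {b. b \<subseteq> {..<n} \<and> insert n b \<in> B}"
  then show "b \<subseteq> {..<n}" by simp
  then have "n \<notin> b" "finite b" by (auto intro: finite_subset)
  moreover have "card (insert n b) = Suc k" using steiner_block(2)[OF assms] b by blast
  ultimately show "card b = k" by simp
next
  fix U assume U: "U \<subseteq> {..<n} \<and> card U = t"
  then have "n \<notin> U" "finite U" by (auto intro: finite_subset)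
  then have "insert n U \<subseteq> {..<Suc n}" "card (insert n U) = Suc t" using U by auto
  with assms have ex1: "\<exists>!b. b \<in> B \<and> insert n U \<subseteq> b" by (rule steiner_ex1)
  define b where "b = (THE b. b \<in> B \<and> insert n U \<subseteq> b)"
  have b: "b \<in> B" "insert n U \<subseteq> b" using theI'[OF ex1] unfolding b_def by simp_all
  have "b \<subseteq> {..<Suc n}" using assms b(1) by (rule steiner_block)
  then have "b - {n} \<subseteq> {..<n}" by (auto simp: less_Suc_eq)
  moreover have "insert n (b - {n}) = b" using b by blast
  ultimately have "b - {n} \<in> {b. b \<subseteq> {..<n} \<and> insert n b \<in> B} \<and> U \<subseteq> b - {n}"
    using b \<open>n \<notin> U\<close> by auto
  moreover have "b' = b - {n}"
    if "b' \<in> {b. b \<subseteq> {..<n} \<and> insert n b \<in> B} \<and> U \<subseteq> b'" for b'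
  proof -
    have "insert n b' = b"
      unfolding b_def using that by (intro the1_equality[OF ex1, symmetric]) auto
    moreover have "n \<notin> b'" using that by auto
    ultimately show ?thesis by auto
  qed
  ultimately show "\<exists>!b. b \<in> {b. b \<subseteq> {..<n} \<and> insert n b \<in> B} \<and> U \<subseteq> b" by (rule ex1I)
qed

text \<open>The multiplicity survives because \<open>K\<close> is a derived block exactly when
  \<open>insert n K\<close> is a block of the original system.\<close>

lemma steiner_cover_derived:
  assumes "steiner_cover (Suc t) (Suc k) (Suc n) g Fs"
  shows "steiner_cover t k n g (map (\<lambda>B. {b. b \<subseteq> {..<n} \<and> insert n b \<in> B}) Fs)"
  unfolding steiner_cover_def
proof (intro conjI allI impI)
  show "\<forall>B\<in>set (map (\<lambda>B. {b. b \<subseteq> {..<n} \<and> insert n b \<in> B}) Fs). steiner t k n B"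
    using assms steiner_derived unfolding steiner_cover_def by auto
next
  fix K assume K: "K \<subseteq> {..<n} \<and> card K = k"
  then have "n \<notin> K" "finite K" by (auto intro: finite_subset)
  then have "insert n K \<subseteq> {..<Suc n}" "card (insert n K) = Suc k" using K by auto
  with assms have "length (filter (\<lambda>B. insert n K \<in> B) Fs) = g" by (rule steiner_cover_count)
  then show "length (filter (\<lambda>B. K \<in> B) (map (\<lambda>B. {b. b \<subseteq> {..<n} \<and> insert n b \<in> B}) Fs)) = g"
    using K by (simp add: filter_map o_def)
qed

section \<open>Ranks in a list and residues\<close>

lemma length_filter_rank_less:
  assumes "c < length xs" "P (xs ! c)"
  shows "length (filter P (take c xs)) < length (filter P xs)"
proof -
  have "length (filter P (take c xs)) < length (filter P (take c xs @ xs ! c # drop (Suc c) xs))"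
    using assms(2) by simp
  then show ?thesis by (simp only: id_take_nth_drop[OF assms(1), symmetric])
qed

text \<open>This makes the selection of a system well defined. Positions are selected, so equal
  systems at different positions remain distinct choices.\<close>

lemma ex1_nth_of_filter_rank:
  assumes "r < length (filter P xs)"
  shows "\<exists>!c. c < length xs \<and> P (xs ! c) \<and> length (filter P (take c xs)) = r"
  using assms
proof (induction xs rule: rev_induct)
  case Nil
  then show ?case by simp
next
  case (snoc x xs)
  show ?case
  proof (cases "r < length (filter P xs)")
    case True
    from snoc.IH[OF this] obtain c where
      c: "c < length xs" "P (xs ! c)" "length (filter P (take c xs)) = r" and
      uniq: "\<And>c'. c' < length xs \<and> P (xs ! c') \<and> length (filter P (take c' xs)) = r \<Longrightarrow> c' = c"
      by blast
    show ?thesis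
    proof (rule ex1I[of _ c])
      show "c < length (xs @ [x]) \<and> P ((xs @ [x]) ! c) \<and> length (filter P (take c (xs @ [x]))) = r"
        using c by (simp add: nth_append)
    next
      fix c' assume c': "c' < length (xs @ [x]) \<and> P ((xs @ [x]) ! c')
        \<and> length (filter P (take c' (xs @ [x]))) = r"
      \<comment> \<open>Position \<open>length xs\<close> has rank
        \<open>length (filter P xs)\<close>, which exceeds \<open>r\<close> here.\<close>
      then have "c' \<noteq> length xs" using True by auto
      then have "c' < length xs" using c' by simp
      then show "c' = c" using c' uniq by (simp add: nth_append)
    qed
  next
    case False
    then have Px: "P x" and r: "r = length (filter P xs)" using snoc.prems by (auto split: if_splits)
    show ?thesis
    proof (rule ex1I[of _ "length xs"])
      show "length xs < length (xs @ [x]) \<and> P ((xs @ [x]) ! length xs)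
        \<and> length (filter P (take (length xs) (xs @ [x]))) = r"
        using Px r by simp
    next
      fix c' assume c': "c' < length (xs @ [x]) \<and> P ((xs @ [x]) ! c')
        \<and> length (filter P (take c' (xs @ [x]))) = r"
      show "c' = length xs"
      proof (rule ccontr)
        assume "c' \<noteq> length xs"
        then have lt: "c' < length xs" using c' by simp
        then show False using length_filter_rank_less[of c' xs P] c' r by (simp add: nth_append)
      qed
    qed
  qed
qed

lemma ex1_add_mod:
  fixes a g r :: nat
  assumes "r < g"
  shows "\<exists>!z. z < g \<and> (a + z) mod g = r"
\<comment> \<open>The witness is \<open>r - a\<close> modulo \<open>g\<close>; writing
  \<open>g - a mod g\<close> avoids truncated subtraction.\<close>
proof (rule ex1I[of _ "(r + (g - a mod g)) mod g"])
  have "(a + (r + (g - a mod g)) mod g) mod g = (a mod g + (r + (g - a mod g))) mod g"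
    by (simp add: mod_simps)
  also have "a mod g + (r + (g - a mod g)) = r + g"
    using assms mod_less_divisor[of g a] by linarith
  finally show "(r + (g - a mod g)) mod g < g \<and> (a + (r + (g - a mod g)) mod g) mod g = r"
    using assms by simp
next
  fix z assume z: "z < g \<and> (a + z) mod g = r"
  have "(r + (g - a mod g)) mod g = ((a + z) mod g + (g - a mod g)) mod g" using z by simp
  also have "\<dots> = (a mod g + z + (g - a mod g)) mod g" by (metis mod_add_left_eq add.assoc)
  also have "a mod g + z + (g - a mod g) = z + g"
    using assms mod_less_divisor[of g a] by linarith
  finally show "z = (r + (g - a mod g)) mod g" using z by simp
qed

section \<open>Points as pairs of a group index \<open>p div g\<close> and a label
  \<open>p mod g\<close>\<close>

definition fibre :: "nat \<Rightarrow> nat \<Rightarrow> nat \<Rightarrow> nat set" where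
  "fibre n g i = {p. p < n * g \<and> p div g = i}"

lemma fibre_eq_image:
  assumes "i < n" "g > 0"
  shows "fibre n g i = (\<lambda>z. i * g + z) ` {..<g}"
proof
  show "fibre n g i \<subseteq> (\<lambda>z. i * g + z) ` {..<g}"
  proof
    fix p assume "p \<in> fibre n g i"
    then have "p = i * g + p mod g" unfolding fibre_def using div_mult_mod_eq[of p g] by simp
    moreover have "p mod g < g" using assms by simp
    ultimately show "p \<in> (\<lambda>z. i * g + z) ` {..<g}" by blast
  qed
next
  have "i * g + z < n * g" if "z < g" for z
  proof -
    have "i * g + z < Suc i * g" using that by simp
    also have "\<dots> \<le> n * g" using assms by (intro mult_le_mono1) simp
    finally show ?thesis .
  qed
  then show "(\<lambda>z. i * g + z) ` {..<g} \<subseteq> fibre n g i" using assms by (auto simp: fibre_def)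
qed

lemma card_fibre:
  assumes "i < n" "g > 0"
  shows "card (fibre n g i) = g"
  unfolding fibre_eq_image[OF assms] by (subst card_image) (auto simp: inj_on_def)

lemma group_structure_fibre:
  assumes "g > 0"
  shows "group_structure n g {..<n * g} (fibre n g ` {..<n})"
  unfolding group_structure_def
proof (intro conjI)
  have ne: "fibre n g i \<noteq> {}" if "i < n" for i
    using card_fibre[OF that assms] assms by auto
  have disj: "fibre n g i \<inter> fibre n g j = {}" if "i \<noteq> j" for i j
    using that by (auto simp: fibre_def)
  show "finite {..<n * g}" "card {..<n * g} = n * g" by auto
  show "partition_on {..<n * g} (fibre n g ` {..<n})"
  proof (rule partition_onI)
    show "\<Union> (fibre n g ` {..<n}) = {..<n * g}"
      by (auto simp: fibre_def less_mult_imp_div_less)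
  next
    fix p q assume "p \<in> fibre n g ` {..<n}" "q \<in> fibre n g ` {..<n}" "p \<noteq> q"
    then show "disjnt p q" by (auto simp: disjnt_def fibre_def)
  next
    show "{} \<notin> fibre n g ` {..<n}" using ne by auto
  qed
  have "inj_on (fibre n g) {..<n}"
  proof (rule inj_onI)
    fix i j assume "i \<in> {..<n}" "j \<in> {..<n}" "fibre n g i = fibre n g j"
    then show "i = j" using ne[of i] disj[of i j] by auto
  qed
  then show "card (fibre n g ` {..<n}) = n" by (simp add: card_image)
  show "\<forall>X\<in>fibre n g ` {..<n}. card X = g" using card_fibre assms by auto
qed

lemma transverse_fibre_iff:
  assumes "S \<subseteq> {..<n * g}"
  shows "transverse (fibre n g ` {..<n}) S \<longleftrightarrow> inj_on (\<lambda>p. p div g) S"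
proof
  have fin: "finite S" using assms by (rule finite_subset) simp
  assume tr: "transverse (fibre n g ` {..<n}) S"
  show "inj_on (\<lambda>p. p div g) S"
  proof (rule inj_onI)
    fix p q assume pq: "p \<in> S" "q \<in> S" "p div g = q div g"
    then have "p div g < n" using assms by (auto simp: less_mult_imp_div_less)
    then have "card (S \<inter> fibre n g (p div g)) \<le> 1" using tr unfolding transverse_def by blast
    moreover have "p \<in> S \<inter> fibre n g (p div g)" "q \<in> S \<inter> fibre n g (p div g)"
      using pq assms by (auto simp: fibre_def)
    ultimately show "p = q" using fin by (metis card_le_Suc0_iff_eq finite_Int One_nat_def)
  qed
next
  have fin: "finite S" using assms by (rule finite_subset) simp
  assume inj: "inj_on (\<lambda>p. p div g) S"
  show "transverse (fibre n g ` {..<n}) S"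
    unfolding transverse_def
  proof
    fix X assume "X \<in> fibre n g ` {..<n}"
    then have "\<forall>p\<in>S \<inter> X. \<forall>q\<in>S \<inter> X. p = q" using inj by (auto simp: fibre_def inj_on_def)
    then show "card (S \<inter> X) \<le> 1" using fin by (simp add: card_le_Suc0_iff_eq)
  qed
qed

lemma admissible_sets_fibre:
  "admissible_sets k {..<n * g} (fibre n g ` {..<n}) =
     {S. S \<subseteq> {..<n * g} \<and> card S = k \<and> inj_on (\<lambda>p. p div g) S}"
  unfolding admissible_sets_def using transverse_fibre_iff by blast

lemma admissible_fibre_projection:
  assumes "S \<in> admissible_sets k {..<n * g} (fibre n g ` {..<n})"
  shows "(\<lambda>p. p div g) ` S \<subseteq> {..<n}" "card ((\<lambda>p. p div g) ` S) = k"
  using assms unfolding admissible_sets_fibre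
  by (auto simp: card_image less_mult_imp_div_less)

section \<open>The large set selected by a covering family\<close>

text \<open>The filtered length counts the systems before position \<open>c\<close> that contain the
  projection of \<open>S\<close>. It is the rank, starting from 0, of \<open>Fs ! c\<close> among
  all systems containing it.\<close>

definition cover_class :: "nat \<Rightarrow> nat \<Rightarrow> nat \<Rightarrow> nat set set list \<Rightarrow> nat \<Rightarrow> nat set set" where
  "cover_class k n g Fs c =
     {S \<in> admissible_sets k {..<n * g} (fibre n g ` {..<n}).
        (\<lambda>p. p div g) ` S \<in> Fs ! c \<and>
        length (filter (\<lambda>B. (\<lambda>p. p div g) ` S \<in> B) (take c Fs)) = (\<Sum>p\<in>S. p mod g) mod g}"

lemma cover_class_H_design:
  assumes cover: "steiner_cover t (Suc t) n g Fs" and g: "g > 0" and c: "c < length Fs"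
  shows "H_design n g (Suc t) t {..<n * g} (fibre n g ` {..<n}) (cover_class (Suc t) n g Fs c)"
  unfolding H_design_def
proof (intro conjI ballI)
  show "group_structure n g {..<n * g} (fibre n g ` {..<n})" by (rule group_structure_fibre[OF g])
  show "cover_class (Suc t) n g Fs c \<subseteq> admissible_sets (Suc t) {..<n * g} (fibre n g ` {..<n})"
    unfolding cover_class_def by blast
next
  fix T assume T: "T \<in> admissible_sets t {..<n * g} (fibre n g ` {..<n})"
  let ?d = "\<lambda>p. p div g"
  note T' = T[unfolded admissible_sets_fibre, simplified]
  have finT: "finite T" using T' by (auto intro: finite_subset)
  have U: "?d ` T \<subseteq> {..<n}" "card (?d ` T) = t" using admissible_fibre_projection[OF T] by auto
  have st: "steiner t (Suc t) n (Fs ! c)" using cover c unfolding steiner_cover_def by simp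
  then have ex1: "\<exists>!K. K \<in> Fs ! c \<and> ?d ` T \<subseteq> K" using U by (rule steiner_ex1)
  \<comment> \<open>\<open>K\<close> is the block of system \<open>c\<close> over the groups met by
    \<open>T\<close>; its one further element \<open>i\<close> is the group of the missing
    point.\<close>
  define K where "K = (THE K. K \<in> Fs ! c \<and> ?d ` T \<subseteq> K)"
  have K: "K \<in> Fs ! c" "?d ` T \<subseteq> K" using theI'[OF ex1] unfolding K_def by simp_all
  have Kn: "K \<subseteq> {..<n}" "card K = Suc t" using steiner_block[OF st K(1)] by auto
  have "card (K - ?d ` T) = 1" using K(2) U(2) Kn(2) finT by (simp add: card_Diff_subset)
  then obtain i where i: "K - ?d ` T = {i}" by (auto simp: card_1_singleton_iff)
  then have iK: "K = insert i (?d ` T)" "i \<notin> ?d ` T" "i < n" using K(2) Kn(1) by auto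
  \<comment> \<open>The rank \<open>r\<close> is below \<open>g\<close>: \<open>Fs ! c\<close> is
    one of the \<open>g\<close> systems containing \<open>K\<close>, but lies outside
    \<open>take c Fs\<close>. Hence a label sum can attain it.\<close>
  define r where "r = length (filter (\<lambda>B. K \<in> B) (take c Fs))"
  have "length (filter (\<lambda>B. K \<in> B) Fs) = g" using cover Kn by (rule steiner_cover_count)
  then have "r < g" using length_filter_rank_less[of c Fs "\<lambda>B. K \<in> B"] c K(1) unfolding r_def by simp
  then obtain z where z: "z < g" "((\<Sum>p\<in>T. p mod g) + z) mod g = r" and
    zuniq: "\<And>z'. z' < g \<and> ((\<Sum>p\<in>T. p mod g) + z') mod g = r \<Longrightarrow> z' = z"
    using ex1_add_mod[of r g "\<Sum>p\<in>T. p mod g"] by blast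
  define q where "q = i * g + z"
  have qd: "q div g = i" "q mod g = z" using z(1) by (auto simp: q_def)
  have "q \<in> fibre n g i" unfolding fibre_eq_image[OF iK(3) g] q_def using z(1) by blast
  then have qn: "q < n * g" by (simp add: fibre_def)
  have qT: "q \<notin> T" using iK(2) qd(1) by auto
  have proj: "?d ` insert q T = K" using iK(1) qd(1) by simp
  have "insert q T \<in> admissible_sets (Suc t) {..<n * g} (fibre n g ` {..<n})"
    unfolding admissible_sets_fibre using T' finT qT qn qd(1) iK(2) by (auto simp: inj_on_insert)
  moreover have "(\<Sum>p\<in>insert q T. p mod g) mod g = r"
    using finT qT qd(2) z(2) by (simp add: add.commute)
  ultimately have mem: "insert q T \<in> cover_class (Suc t) n g Fs c"
    unfolding cover_class_def using K(1) proj unfolding r_def by simp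
  show "\<exists>!b. b \<in> cover_class (Suc t) n g Fs c \<and> T \<subseteq> b"
  proof (rule ex1I[of _ "insert q T"])
    show "insert q T \<in> cover_class (Suc t) n g Fs c \<and> T \<subseteq> insert q T" using mem by blast
  next
    \<comment> \<open>Any block of the class over \<open>T\<close> also projects to
      \<open>K\<close>, so its extra point lies in group \<open>i\<close> and its label solves the
      congruence that determines \<open>z\<close>.\<close>
    fix b assume b: "b \<in> cover_class (Suc t) n g Fs c \<and> T \<subseteq> b"
    then have adm: "b \<in> admissible_sets (Suc t) {..<n * g} (fibre n g ` {..<n})"
      and bF: "?d ` b \<in> Fs ! c"
      and rk: "length (filter (\<lambda>B. ?d ` b \<in> B) (take c Fs)) = (\<Sum>p\<in>b. p mod g) mod g"
      unfolding cover_class_def by auto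
    have "?d ` T \<subseteq> ?d ` b" using b by (intro image_mono) simp
    then have bK: "?d ` b = K"
      unfolding K_def using bF by (intro the1_equality[OF ex1, symmetric]) simp
    note adm' = adm[unfolded admissible_sets_fibre, simplified]
    have "finite b" using adm' by (auto intro: finite_subset)
    then have "card (b - T) = 1" using b adm' T' finT by (simp add: card_Diff_subset)
    then obtain q' where q': "b - T = {q'}" by (auto simp: card_1_singleton_iff)
    then have bq: "b = insert q' T" "q' \<notin> T" using b by auto
    have "?d q' \<notin> ?d ` T" using adm' bq by (auto simp: inj_on_def)
    then have "?d q' = i" using bK bq(1) i by auto
    moreover have "q' mod g = z"
      using zuniq[of "q' mod g"] rk bK bq finT g unfolding r_def by (simp add: add.commute)
    ultimately have "q' = q" unfolding q_def using div_mult_mod_eq[of q' g] by simp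
    then show "b = insert q T" using bq(1) by simp
  qed
qed

lemma large_H_set_of_steiner_cover:
  assumes cover: "steiner_cover t (Suc t) n g Fs" and g: "g > 0" and tn: "t \<le> n"
  shows "\<exists>(Q :: nat set) G L. large_H_set n g (Suc t) t Q G L"
proof -
  let ?Q = "{..<n * g}" and ?G = "fibre n g ` {..<n}" and ?d = "\<lambda>p. p div g"
  let ?C = "cover_class (Suc t) n g Fs"
  \<comment> \<open>Exactly \<open>g\<close> systems contain the projection of \<open>S\<close>, so
    every residue modulo \<open>g\<close> is the rank of one of them.\<close>
  have ex1: "\<exists>!c. c < length Fs \<and> S \<in> ?C c" if S: "S \<in> admissible_sets (Suc t) ?Q ?G" for S
  proof -
    have "length (filter (\<lambda>B. ?d ` S \<in> B) Fs) = g"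
      using cover admissible_fibre_projection[OF S] by (rule steiner_cover_count)
    then have "(\<Sum>p\<in>S. p mod g) mod g < length (filter (\<lambda>B. ?d ` S \<in> B) Fs)" using g by simp
    from ex1_nth_of_filter_rank[OF this] show ?thesis using S unfolding cover_class_def by simp
  qed
  have design: "H_design n g (Suc t) t ?Q ?G (?C c)" if "c < length Fs" for c
    by (rule cover_class_H_design[OF cover g that])
  \<comment> \<open>Parts of a partition must be nonempty. The points with label 0 in the first
    \<open>t\<close> groups form a transverse \<open>t\<close>-set, and every class has a block over
    it.\<close>
  have "inj_on (\<lambda>i. i * g) {..<t}" using g by (auto simp: inj_on_def)
  moreover have "i * g < n * g" if "i < t" for i using that tn g by simp
  moreover have "inj_on ?d ((\<lambda>i. i * g) ` {..<t})" using g by (auto simp: inj_on_def)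
  ultimately have T: "(\<lambda>i. i * g) ` {..<t} \<in> admissible_sets t ?Q ?G"
    unfolding admissible_sets_fibre by (auto simp: card_image)
  have ne: "?C c \<noteq> {}" if "c < length Fs" for c
  proof -
    have "\<exists>!b. b \<in> ?C c \<and> (\<lambda>i. i * g) ` {..<t} \<subseteq> b"
      using design[OF that, unfolded H_design_def] T by (elim conjE) (rule bspec)
    then have "\<exists>b. b \<in> ?C c \<and> (\<lambda>i. i * g) ` {..<t} \<subseteq> b" by (rule ex1_implies_ex)
    then show ?thesis by (elim exE) auto
  qed
  have "partition_on (admissible_sets (Suc t) ?Q ?G) (?C ` {..<length Fs})"
  proof (rule partition_onI)
    show "\<Union> (?C ` {..<length Fs}) = admissible_sets (Suc t) ?Q ?G"
    proof
      show "\<Union> (?C ` {..<length Fs}) \<subseteq> admissible_sets (Suc t) ?Q ?G"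
        unfolding cover_class_def by blast
      show "admissible_sets (Suc t) ?Q ?G \<subseteq> \<Union> (?C ` {..<length Fs})"
        using ex1_implies_ex[OF ex1] by auto
    qed
  next
    fix X Y assume "X \<in> ?C ` {..<length Fs}" "Y \<in> ?C ` {..<length Fs}" "X \<noteq> Y"
    then obtain c c' where c: "c < length Fs" "c' < length Fs" "X = ?C c" "Y = ?C c'" "c \<noteq> c'" by blast
    show "disjnt X Y"
      unfolding disjnt_iff
    proof (intro allI notI)
      fix S assume S: "S \<in> X \<and> S \<in> Y"
      then have "S \<in> admissible_sets (Suc t) ?Q ?G" unfolding c(3) cover_class_def by blast
      from ex1[OF this] show False using S c by (elim alt_ex1E) blast
    qed
  next
    show "{} \<notin> ?C ` {..<length Fs}" using ne by auto
  qed
  then have "large_H_set n g (Suc t) t ?Q ?G (?C ` {..<length Fs})"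
    unfolding large_H_set_def using design group_structure_fibre[OF g] by blast
  then show ?thesis by blast
qed

section \<open>An explicit S(5,6,12) and two families of rearrangements\<close>

text \<open>
  A decision tree for the 66 blocks of a Steiner system S(4,5,11). It is meaningful only for
  characteristic vectors of weight 5; on other vectors its value is arbitrary. Nested conditionals
  are used because rewriting evaluates them lazily.
\<close>
definition pentad :: "bool \<Rightarrow> bool \<Rightarrow> bool \<Rightarrow> bool \<Rightarrow> bool \<Rightarrow> bool \<Rightarrow> bool \<Rightarrow> bool \<Rightarrow> bool \<Rightarrow> bool \<Rightarrow> bool \<Rightarrow> bool" where
  "pentad a b c d e f g h i j k \<longleftrightarrow>
    (if a then (if b then (if c then (if d then k
           else if k then False else if e then f else if f then False else if g then j else \<not> j)
         else if d then (if k then False else if e then h else if h then False else if f then g else \<not> g)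
         else if k then (if e then j else if j then False else if f then i else \<not> i) else if e then (if g then i else False) else if g then False else \<not> i)
       else if c then (if d then (if k then False else if e then j else if j then False else if f then h else \<not> h)
         else if k then (if e then i else if i then False else if f then g else \<not> g) else if e then (if g then h else False) else if g then False else \<not> h)
       else if d then (if k then (if e then g else if g then False else if f then j else \<not> j) else if e then (if f then i else False) else if f then False else \<not> i)
       else if k then (if e then (if f then h else False) else if f then False else \<not> h) else if e then (if j then (if f then g else \<not> g) else False) else \<not> j)
     else if b then (if c then (if d then (if k then False else if e then i else if i then False else if f then j else \<not> j)
         else if k then (if e then g else if g then False else if f then h else \<not> h) else if e then (if h then j else False) else if h then False else \<not> j)
       else if d then (if k then (if e then f else if f then False else if g then i else \<not> i) else if e then (if g then j else False) else if g then False else \<not> j)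
       else if k then (if e then (if h then i else False) else if h then False else \<not> i) else if e then (if f then (if g then h else \<not> h) else False) else \<not> f)
     else if c then (if d then (if k then (if e then h else if h then False else if f then i else \<not> i) else if e then (if f then g else False) else if f then False else \<not> g)
       else if k then (if e then (if f then j else False) else if f then False else \<not> j) else if e then (if i then (if f then h else \<not> h) else False) else \<not> i)
     else if d then (if k then (if e then (if i then j else False) else if i then False else \<not> j) else if e then (if h then (if f then j else \<not> j) else False) else \<not> h)
     else if k then (if e then (if g then (if f then i else \<not> i) else False) else \<not> g) else False)"

text \<open>
  S(5,6,12) extends S(4,5,11) by one point and is closed under complementation.
\<close>
fun hexad :: "bool list \<Rightarrow> bool" where
  "hexad [a, b, c, d, e, f, g, h, i, j, k, l] \<longleftrightarrow>
    (if l then pentad a b c d e f g h i j k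
     else pentad (\<not> a) (\<not> b) (\<not> c) (\<not> d) (\<not> e) (\<not> f) (\<not> g) (\<not> h) (\<not> i) (\<not> j) (\<not> k))"
| "hexad _ \<longleftrightarrow> False"

text \<open>
  The first eleven rows are one orbit of the 11-cycle \<open>(a b \<dots> k)\<close>; the last three
  are rearrangements for which the system of hexads is invariant under that cycle. The repetition of
  the last row is intended.
\<close>
fun rows2 :: "'a list \<Rightarrow> 'a list list" where
  "rows2 [a, b, c, d, e, f, g, h, i, j, k, l] =
    [[g, c, i, d, e, f, a, b, j, h, k, l],
     [h, d, j, e, f, g, b, c, k, i, a, l],
     [i, e, k, f, g, h, c, d, a, j, b, l],
     [j, f, a, g, h, i, d, e, b, k, c, l],
     [k, g, b, h, i, j, e, f, c, a, d, l],
     [a, h, c, i, j, k, f, g, d, b, e, l],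
     [b, i, d, j, k, a, g, h, e, c, f, l],
     [c, j, e, k, a, b, h, i, f, d, g, l],
     [d, k, f, a, b, c, i, j, g, e, h, l],
     [e, a, g, b, c, d, j, k, h, f, i, l],
     [f, b, h, c, d, e, k, a, i, g, j, l],
     [h, a, i, d, e, f, g, b, c, j, k, l],
     [c, b, i, l, e, f, g, h, d, j, k, a],
     [c, b, i, l, e, f, g, h, d, j, k, a]]"
| "rows2 _ = []"

text \<open>
  The orbit of the identity arrangement under the permutation
  \<open>(a b c d e f g) (h i j)\<close> of order 21.
\<close>
fun rows3 :: "'a list \<Rightarrow> 'a list list" where
  "rows3 [a, b, c, d, e, f, g, h, i, j, k, l] =
    [[a, b, c, d, e, f, g, h, i, j, k, l],
     [b, c, d, e, f, g, a, i, j, h, k, l],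
     [c, d, e, f, g, a, b, j, h, i, k, l],
     [d, e, f, g, a, b, c, h, i, j, k, l],
     [e, f, g, a, b, c, d, i, j, h, k, l],
     [f, g, a, b, c, d, e, j, h, i, k, l],
     [g, a, b, c, d, e, f, h, i, j, k, l],
     [a, b, c, d, e, f, g, i, j, h, k, l],
     [b, c, d, e, f, g, a, j, h, i, k, l],
     [c, d, e, f, g, a, b, h, i, j, k, l],
     [d, e, f, g, a, b, c, i, j, h, k, l],
     [e, f, g, a, b, c, d, j, h, i, k, l],
     [f, g, a, b, c, d, e, h, i, j, k, l],
     [g, a, b, c, d, e, f, i, j, h, k, l],
     [a, b, c, d, e, f, g, j, h, i, k, l],
     [b, c, d, e, f, g, a, h, i, j, k, l],
     [c, d, e, f, g, a, b, i, j, h, k, l],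
     [d, e, f, g, a, b, c, j, h, i, k, l],
     [e, f, g, a, b, c, d, h, i, j, k, l],
     [f, g, a, b, c, d, e, i, j, h, k, l],
     [g, a, b, c, d, e, f, j, h, i, k, l]]"
| "rows3 _ = []"

section \<open>Exhaustive checks over vectors of fixed weight\<close>

text \<open>
  The vector is accumulated in an argument, and the predicate is always a constant or a partial
  application: rewriting would otherwise expand it symbolically under a binder.
\<close>
fun all_vectors :: "nat \<Rightarrow> nat \<Rightarrow> (bool list \<Rightarrow> bool) \<Rightarrow> bool list \<Rightarrow> bool" where
  "all_vectors 0 k P w \<longleftrightarrow> (if k = 0 then P w else True)"
| "all_vectors (Suc n) 0 P w \<longleftrightarrow> all_vectors n 0 P (False # w)"
| "all_vectors (Suc n) (Suc k) P w \<longleftrightarrow>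
     all_vectors n (Suc k) P (False # w) \<and> all_vectors n k P (True # w)"

text \<open>Entries are pushed onto the front of the accumulator, so \<open>v\<close> reappears
  reversed; the induction needs an arbitrary \<open>w\<close>.\<close>

lemma all_vectors_append:
  assumes "all_vectors n k P w" "length v = n" "length (filter (\<lambda>x. x) v) = k"
  shows "P (rev v @ w)"
  using assms
proof (induction n k P w arbitrary: v rule: all_vectors.induct)
  case (1 k P w)
  then show ?case by (simp split: if_splits)
next
  case (2 n P w)
  then obtain x u where v: "v = x # u" by (cases v) auto
  then have "\<not> x" using 2(4) by auto
  then show ?case using 2 v by auto
next
  case (3 n k P w)
  then obtain x u where v: "v = x # u" by (cases v) auto
  then show ?case using 3 by (cases x) auto
qed

lemma all_vectorsD:
  assumes "all_vectors n k P []" "length v = n" "length (filter (\<lambda>x. x) v) = k"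
  shows "P v"
  using all_vectors_append[OF assms(1), of "rev v"] assms(2,3) by (simp add: rev_filter[symmetric])

text \<open>Setting a position that is already set would leave a vector of weight 5, where
  \<open>hexad\<close> is arbitrary. The conditional discards such positions before
  \<open>hexad\<close> is evaluated.\<close>

definition unique_completion :: "bool list \<Rightarrow> bool" where
  "unique_completion v \<longleftrightarrow>
     length (filter (\<lambda>j. if v ! j then False else hexad (v[j := True])) [0..<12]) = 1"

definition hexad_count :: "(bool list \<Rightarrow> bool list list) \<Rightarrow> nat \<Rightarrow> bool list \<Rightarrow> bool" where
  "hexad_count R g v \<longleftrightarrow> length (filter hexad (R v)) = g"

text \<open>Evaluation over all 792 vectors of weight 5: this is the Steiner property of the
  hexads.\<close>

lemma hexad_unique_completion: "all_vectors 12 5 unique_completion []"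
  by code_simp

text \<open>Evaluation over all 924 vectors of weight 6. The number of rows fits: 14 copies of 132
  hexads make 2 * 924.\<close>

lemma rows2_count: "all_vectors 12 6 (hexad_count rows2 2) []"
  by code_simp

lemma rows3_count: "all_vectors 12 6 (hexad_count rows3 3) []"
  by code_simp

section \<open>Steiner systems and coverings from arrangements of the points\<close>

lemma rows2_map: "rows2 (map f xs) = map (map f) (rows2 xs)"
  by (cases xs rule: rows2.cases) simp_all

lemma rows3_map: "rows3 (map f xs) = map (map f) (rows3 xs)"
  by (cases xs rule: rows3.cases) simp_all

text \<open>Reading membership in the order \<open>p\<close> gives an isomorphic copy of the hexad
  system for each arrangement \<open>p\<close>. The size is required separately because
  \<open>hexad\<close> is meaningful only at weight 6.\<close>

definition hexads :: "nat list \<Rightarrow> nat set set" where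
  "hexads p = {K. K \<subseteq> {..<12} \<and> card K = 6 \<and> hexad (map (\<lambda>i. i \<in> K) p)}"

lemma weight_indicator:
  assumes "distinct p" "K \<subseteq> set p"
  shows "length (filter (\<lambda>x. x) (map (\<lambda>i. i \<in> K) p)) = card K"
proof -
  have "length (filter (\<lambda>x. x) (map (\<lambda>i. i \<in> K) p)) = length (filter (\<lambda>i. i \<in> K) p)"
    by (simp add: filter_map o_def)
  also have "\<dots> = card (set (filter (\<lambda>i. i \<in> K) p))" using assms(1) by (intro distinct_card[symmetric]) simp
  also have "set (filter (\<lambda>i. i \<in> K) p) = K" using assms(2) by auto
  finally show ?thesis .
qed

lemma steiner_hexads:
  assumes p: "distinct p" "set p = {..<12}"
  shows "steiner 5 6 12 (hexads p)"
  unfolding steiner_def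
proof (intro conjI ballI allI impI)
  fix b assume "b \<in> hexads p"
  then show "b \<subseteq> {..<12}" "card b = 6" by (auto simp: hexads_def)
next
  fix U :: "nat set" assume U: "U \<subseteq> {..<12} \<and> card U = 5"
  have len: "length p = 12" using distinct_card[OF p(1)] p(2) by simp
  have finU: "finite U" using U by (auto intro: finite_subset)
  define v where "v = map (\<lambda>i. i \<in> U) p"
  define P where "P j \<longleftrightarrow> (if v ! j then False else hexad (v[j := True]))" for j
  have "length v = 12" "length (filter (\<lambda>x. x) v) = 5"
    using len weight_indicator[OF p(1), of U] U p(2) by (auto simp: v_def)
  with hexad_unique_completion have "unique_completion v" by (rule all_vectorsD)
  then have "length (filter P [0..<12]) = 1" unfolding P_def unique_completion_def .
  then obtain j where "filter P [0..<12] = [j]" by (auto simp: length_Suc_conv)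
  then have "set (filter P [0..<12]) = {j}" by (simp only: list.set)
  then have "{x. x < 12 \<and> P x} = {j}"
    by (simp only: set_filter set_upt atLeast0LessThan lessThan_iff)
  then have j: "j < 12" "P j" and juniq: "\<And>x. x < 12 \<Longrightarrow> P x \<Longrightarrow> x = j" by auto
  \<comment> \<open>As \<open>p\<close> has no repetition, setting position \<open>x\<close> of the
    vector adds exactly the point \<open>p ! x\<close> to \<open>U\<close>.\<close>
  have P_iff: "P x \<longleftrightarrow> p ! x \<notin> U \<and> hexad (map (\<lambda>i. i \<in> insert (p ! x) U) p)" if "x < 12" for x
  proof -
    have "v[x := True] = map (\<lambda>i. i \<in> insert (p ! x) U) p"
      using that len p(1) by (intro nth_equalityI) (auto simp: v_def nth_list_update nth_eq_iff_index_eq)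
    then show ?thesis unfolding P_def using that len by (simp add: v_def)
  qed
  have pj: "p ! j < 12" using j(1) len p(2) nth_mem[of j p] by auto
  show "\<exists>!b. b \<in> hexads p \<and> U \<subseteq> b"
  proof (rule ex1I[of _ "insert (p ! j) U"])
    show "insert (p ! j) U \<in> hexads p \<and> U \<subseteq> insert (p ! j) U"
      using j P_iff[OF j(1)] pj U finU by (auto simp: hexads_def)
  next
    fix b assume b: "b \<in> hexads p \<and> U \<subseteq> b"
    then have b': "b \<subseteq> {..<12}" "card b = 6" "hexad (map (\<lambda>i. i \<in> b) p)" "U \<subseteq> b"
      by (auto simp: hexads_def)
    have "card (b - U) = 1" using b' U finU by (simp add: card_Diff_subset)
    then obtain y where y: "b - U = {y}" by (auto simp: card_1_singleton_iff)
    then have bU: "b = insert y U" "y \<notin> U" "y \<in> set p" using b' p(2) by auto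
    then obtain x where x: "x < 12" "y = p ! x" using len by (auto simp: in_set_conv_nth)
    then have "P x" using P_iff[OF x(1)] bU b'(3) by simp
    then show "b = insert (p ! j) U" using juniq[OF x(1)] x bU by simp
  qed
qed

text \<open>\<open>R\<close> rearranges points and \<open>S\<close> truth values. Both stand for one
  polymorphic function, which a variable cannot be at two types; the naturality assumption
  \<open>nat\<close> links them and turns counting systems into counting hexads among rows.\<close>

lemma steiner_cover_rows:
  assumes "\<forall>p\<in>set (R [0..<12]). distinct p \<and> set p = {..<12}"
    and nat: "\<And>K. map (map (\<lambda>i. i \<in> K)) (R [0..<12]) = S (map (\<lambda>i. i \<in> K) [0..<12])"
    and count: "all_vectors 12 6 (hexad_count S g) []"
  shows "steiner_cover 5 6 12 g (map hexads (R [0..<12]))"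
  unfolding steiner_cover_def
proof (intro conjI allI impI)
  show "\<forall>B\<in>set (map hexads (R [0..<12])). steiner 5 6 12 B" using assms(1) steiner_hexads by auto
next
  fix K :: "nat set" assume K: "K \<subseteq> {..<12} \<and> card K = 6"
  have "length (filter (\<lambda>B. K \<in> B) (map hexads (R [0..<12])))
      = length (filter hexad (map (map (\<lambda>i. i \<in> K)) (R [0..<12])))"
    using K by (simp add: filter_map o_def hexads_def)
  also have "\<dots> = length (filter hexad (S (map (\<lambda>i. i \<in> K) [0..<12])))" by (simp only: nat)
  also have "\<dots> = g"
    unfolding hexad_count_def[symmetric] by (rule all_vectorsD[OF count])
      (use K weight_indicator[of "[0..<12]" K] in \<open>auto simp: atLeast0LessThan\<close>)
  finally show "length (filter (\<lambda>B. K \<in> B) (map hexads (R [0..<12]))) = g" .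
qed

lemma permutation_of_lessThan:
  assumes "distinct p" "length p = n" "list_all (\<lambda>i. i < n) p"
  shows "set p = {..<n}"
proof (rule card_subset_eq)
  show "set p \<subseteq> {..<n}" using assms(3) by (auto simp: list_all_iff)
  show "card (set p) = card {..<n}" using assms by (simp add: distinct_card)
qed simp

lemma steiner_cover_2: "steiner_cover 5 6 12 2 (map hexads (rows2 [0..<12]))"
proof (rule steiner_cover_rows)
  have "list_all (\<lambda>p. distinct p \<and> length p = 12 \<and> list_all (\<lambda>i. i < 12) p) (rows2 [0..<12::nat])"
    by code_simp
  then show "\<forall>p\<in>set (rows2 [0..<12]). distinct p \<and> set p = {..<12}"
    using permutation_of_lessThan[of _ 12] unfolding list_all_iff by blast
qed (rule rows2_map[symmetric], rule rows2_count)

lemma steiner_cover_3: "steiner_cover 5 6 12 3 (map hexads (rows3 [0..<12]))"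
proof (rule steiner_cover_rows)
  have "list_all (\<lambda>p. distinct p \<and> length p = 12 \<and> list_all (\<lambda>i. i < 12) p) (rows3 [0..<12::nat])"
    by code_simp
  then show "\<forall>p\<in>set (rows3 [0..<12]). distinct p \<and> set p = {..<12}"
    using permutation_of_lessThan[of _ 12] unfolding list_all_iff by blast
qed (rule rows3_map[symmetric], rule rows3_count)

section \<open>All multiplicities and the theorem\<close>

lemma steiner_cover_exists:
  assumes "g \<ge> 2"
  shows "\<exists>Fs. steiner_cover 5 6 12 g Fs"
  using assms
proof (induction g rule: less_induct)
  case (less g)
  consider "g = 2" | "g = 3" | "g \<ge> 4" using less.prems by linarith
  then show ?case
  proof cases
    \<comment> \<open>Here \<open>g\<close> is at least 4, so \<open>g - 2\<close> is at least 2,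
      and the covering of multiplicity 2 is appended.\<close>
    case 3
    then have "\<exists>Fs. steiner_cover 5 6 12 (g - 2) Fs" by (intro less.IH) auto
    then obtain Fs where "steiner_cover 5 6 12 (g - 2) Fs" by (elim exE)
    from steiner_cover_append[OF this steiner_cover_2]
    have "steiner_cover 5 6 12 (g - 2 + 2) (Fs @ map hexads (rows2 [0..<12]))" .
    moreover have "g - 2 + 2 = g" using 3 by simp
    ultimately show ?thesis by (intro exI) (simp only:)
  qed (use steiner_cover_2 steiner_cover_3 in auto)
qed

theorem theorem24:
  fixes g :: nat
  assumes "g \<ge> 2" and "g \<notin> {3, 5, 7, 9, 11, 13}"
  shows "(\<exists>(Q :: nat set) G L. large_H_set 11 g 5 4 Q G L) \<and>
         (\<exists>(Q :: nat set) G L. large_H_set 12 g 6 5 Q G L)"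
proof -
  obtain Fs where cover: "steiner_cover 5 6 12 g Fs" using steiner_cover_exists[OF assms(1)] by (elim exE)
  have g: "g > 0" using assms(1) by simp
  have "steiner_cover 5 (Suc 5) 12 g Fs" using cover by simp
  from large_H_set_of_steiner_cover[OF this g]
  have "\<exists>(Q :: nat set) G L. large_H_set 12 g 6 5 Q G L" by simp
  \<comment> \<open>Deriving at the point 11, the last of the twelve, gives S(4,5,11) with the same
    multiplicity.\<close>
  moreover have "steiner_cover (Suc 4) (Suc 5) (Suc 11) g Fs" using cover by simp
  from steiner_cover_derived[OF this]
  have "steiner_cover 4 (Suc 4) 11 g (map (\<lambda>B. {b. b \<subseteq> {..<11} \<and> insert 11 b \<in> B}) Fs)" by simp
  from large_H_set_of_steiner_cover[OF this g]
  have "\<exists>(Q :: nat set) G L. large_H_set 11 g 5 4 Q G L" by simp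
  ultimately show ?thesis by simp
qed

end
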